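(* Let $X,Y$ be sets, let $H$ be a family of mappings from $X$ to $Y$, let $E$ and $G$ be Banach spaces, and let $K$ be a compact Hausdorff topological space. Let $R: K\times E\times G\to[0,\infty)$ and $S: H\times E\times G\to[0,\infty)$ be mappings such that for all $x\in E$, $b\in G$ the map $\varphi\mapsto R(\varphi,x,b)$ is continuous on $K$, and such that $S(u,0,b)=S(v,x,0)=0=R(\phi,0,b)=R(\varphi,x,0)$ for all $u,v\in H$, $x\in E$, $b\in G$, $\phi,\varphi\in K$. Let $(\Omega,\Sigma,\mu)$ be a finite, positive, non-atomic measure space with $\mu(\Omega)>0$. Let $M$ (respectively $N$) be a set of ($\mu$-a.e. equivalence classes of) strongly measurable functions $\Omega\to E$ (respectively $\Omega\to G$) that contains all simple functions, and assume that $w\mapsto R(\varphi,f(w),g(w))$ is $\mu$-integrable for all $\varphi\in K$, $f\in M$, $g\in N$. Let $u\in H$. Then $u$ is $RS$-abstract $1$-summing if and only if there is a constant $C>0$ such that $$\int_\Omega S(u,f(w),g(w))\,d\mu(w)\le C\sup_{\varphi\in K}\int_\Omega R(\varphi,f(w),g(w))\,d\mu(w)$$ for all simple functions $f\in M$ and all simple functions $g\in N$.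
   Context: A mapping $u\in H$ is called $RS$-abstract $p$-summing ($0<p<\infty$) if there is a constant $C_1>0$ such that $$\Big(\sum_{j=1}^m S(u,x_j,b_j)^p\Big)^{1/p}\le C_1\sup_{\varphi\in K}\Big(\sum_{j=1}^m R(\varphi,x_j,b_j)^p\Big)^{1/p}$$ for all $m\in\mathbb N$, $x_1,\dots,x_m\in E$ and $b_1,\dots,b_m\in G$. A simple function is a measurable function taking finitely many values. *)

theory Defs
  imports "HOL-Analysis.Analysis"
begin

(* The suprema are taken in [0,\<infinity>] (ennreal), so that the supremum over an empty K is 0 and
   an unbounded one is \<infinity>; in type real both would be unspecified values.
   The definition is meant for 0 < p. *)
definition RS_abstract_summing ::
  "'k topology \<Rightarrow> ('k \<Rightarrow> 'e \<Rightarrow> 'g \<Rightarrow> real) \<Rightarrow> ('u \<Rightarrow> 'e \<Rightarrow> 'g \<Rightarrow> real) \<Rightarrow> real \<Rightarrow> 'u \<Rightarrow> bool" where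
  "RS_abstract_summing K R S p u \<longleftrightarrow>
    (\<exists>C1>0. \<forall>(m::nat) (x::nat \<Rightarrow> 'e) (b::nat \<Rightarrow> 'g).
       ennreal ((\<Sum>j=1..m. S u (x j) (b j) powr p) powr (1 / p))
         \<le> ennreal C1 *
           (SUP \<phi>\<in>topspace K. ennreal ((\<Sum>j=1..m. R \<phi> (x j) (b j) powr p) powr (1 / p))))"

definition non_atomic :: "'w measure \<Rightarrow> bool" where
  "non_atomic \<mu> \<longleftrightarrow>
    (\<forall>A\<in>sets \<mu>. 0 < emeasure \<mu> A \<longrightarrow>
       (\<exists>B\<in>sets \<mu>. B \<subseteq> A \<and> 0 < emeasure \<mu> B \<and> emeasure \<mu> B < emeasure \<mu> A))"

definition strongly_measurable :: "'w measure \<Rightarrow> ('w \<Rightarrow> 'e::topological_space) \<Rightarrow> bool" where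
  "strongly_measurable \<mu> f \<longleftrightarrow>
    (\<exists>s. (\<forall>n::nat. simple_function \<mu> (s n)) \<and> (AE w in \<mu>. (\<lambda>n. s n w) \<longlonglongrightarrow> f w))"

definition ae_eq :: "'w measure \<Rightarrow> (('w \<Rightarrow> 'e::topological_space) \<times> ('w \<Rightarrow> 'e)) set" where
  "ae_eq \<mu> = {(f, g). strongly_measurable \<mu> f \<and> strongly_measurable \<mu> g \<and> (AE w in \<mu>. f w = g w)}"

(* For a set M of classes, "f \<in> M" as said of a function f is "f \<in> \<Union>M". *)
definition strongly_measurable_classes :: "'w measure \<Rightarrow> ('w \<Rightarrow> 'e::topological_space) set set" where
  "strongly_measurable_classes \<mu> = {f. strongly_measurable \<mu> f} // ae_eq \<mu>"

lemma equiv_ae_eq: "equiv {f. strongly_measurable \<mu> f} (ae_eq \<mu>)"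
  unfolding equiv_def refl_on_def sym_def trans_def ae_eq_def
  by (auto elim: eventually_mono eventually_elim2)

end

theory Submission
  imports Defs
begin

text \<open>
  A family of vectors in which \<open>y\<close> is repeated \<open>n y\<close> times turns the summing inequality into
  \<open>\<Sum>y. n y * S y \<le> C * (SUP \<phi>. \<Sum>y. n y * R \<phi> y)\<close>. For simple functions the integrals are such
  sums with the measures \<open>a y\<close> of the level sets as weights. Put \<open>n y = \<lfloor>k * a y\<rfloor>\<close>, divide by \<open>k\<close>
  and let \<open>k\<close> tend to infinity: rounding down only decreases the right-hand side, so
  no uniformity in \<open>\<phi>\<close> is needed. Conversely, by Sierpinski's theorem a non-atomic space splits into
  \<open>m\<close> pieces of equal positive measure \<open>c\<close>; functions that take the values \<open>x j\<close> and \<open>b j\<close> on the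
  \<open>j\<close>-th piece turn the integrals into \<open>c\<close> times the sums in question.
\<close>

subsection \<open>Sierpinski's theorem\<close>

context finite_measure
begin

text \<open>A proper piece \<open>B\<close> and its complement \<open>A - B\<close> both have
  positive measure, and the smaller of the two has at most half the measure of
  \<open>A\<close>.\<close>

lemma non_atomic_half_subset:
  assumes "non_atomic M" and A: "A \<in> sets M" "0 < measure M A"
  obtains B where "B \<in> sets M" "B \<subseteq> A" "0 < measure M B" "measure M B \<le> measure M A / 2"
proof -
  obtain B where B: "B \<in> sets M" "B \<subseteq> A" "0 < measure M B" "measure M B < measure M A"
    using assms unfolding non_atomic_def emeasure_eq_measure
    by (auto simp: ennreal_less_iff)
  have "measure M (A - B) = measure M A - measure M B"
    using A B by (simp add: finite_measure_Diff)
  then show thesis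
    using that[of B] that[of "A - B"] A B by (cases "measure M B \<le> measure M A / 2") auto
qed

text \<open>Halving \<open>n\<close> times leaves a set of positive measure at most
  \<open>measure M A * (1 / 2) ^ n\<close>.\<close>

lemma non_atomic_small_subset:
  assumes na: "non_atomic M" and A: "A \<in> sets M" "0 < measure M A" and "0 < e"
  obtains B where "B \<in> sets M" "B \<subseteq> A" "0 < measure M B" "measure M B < e"
proof -
  have ex: "\<exists>B\<in>sets M. B \<subseteq> A \<and> 0 < measure M B \<and> measure M B \<le> measure M A * (1 / 2) ^ n" for n
  proof (induction n)
    case (Suc n)
    then obtain B where B: "B \<in> sets M" "B \<subseteq> A" "0 < measure M B"
      "measure M B \<le> measure M A * (1 / 2) ^ n" by blast
    obtain D where "D \<in> sets M" "D \<subseteq> B" "0 < measure M D" "measure M D \<le> measure M B / 2"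
      using non_atomic_half_subset[OF na B(1,3)] .
    with B show ?case by (intro bexI[of _ D]) auto
  qed (use A in auto)
  obtain n where "(1 / 2) ^ n < e / measure M A"
    using real_arch_pow_inv[of "e / measure M A" "1 / 2"] A \<open>0 < e\<close> by auto
  then have "measure M A * (1 / 2) ^ n < e"
    using A by (simp add: field_simps)
  with ex[of n] that show thesis by force
qed

text \<open>Greedy exhaustion: an increasing chain of subsets of measure at most \<open>t\<close>
  grows nearly as fast as possible. Its gains tend to 0, so nothing of positive measure can still be
  added to its union without exceeding \<open>t\<close>; small subsets then rule out a union of
  measure below \<open>t\<close>.\<close>

theorem non_atomic_intermediate_value:
  assumes na: "non_atomic M" and A: "A \<in> sets M" and t: "0 \<le> t" "t \<le> measure M A"
  obtains B where "B \<in> sets M" "B \<subseteq> A" "measure M B = t"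
proof -
  define P where "P B \<longleftrightarrow> B \<in> sets M \<and> B \<subseteq> A \<and> measure M B \<le> t" for B
  \<comment> \<open>\<open>D\<close> gains at least half of what any admissible enlargement of \<open>B\<close> can gain.\<close>
  define Q where "Q B D \<longleftrightarrow> B \<subseteq> D \<and>
    (\<forall>D'. P D' \<longrightarrow> B \<subseteq> D' \<longrightarrow> measure M D' - measure M B \<le> 2 * (measure M D - measure M B))" for B D
  have step: "\<exists>D. P D \<and> Q B D" if "P B" for B
  proof -
    define V where "V = measure M ` {D. P D \<and> B \<subseteq> D}"
    have bdd: "bdd_above V" unfolding V_def P_def by (auto intro!: bdd_aboveI[of _ t])
    have ne: "measure M B \<in> V" using that by (auto simp: V_def)
    have up: "measure M D' \<le> Sup V" if "P D'" "B \<subseteq> D'" for D'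
      using that bdd by (intro cSup_upper) (auto simp: V_def)
    show ?thesis
    \<comment> \<open>If no enlargement gains anything, \<open>B\<close> itself serves as
      \<open>D\<close>. Otherwise any \<open>D\<close> above the midpoint of
      \<open>measure M B\<close> and \<open>Sup V\<close> gains at least half of the possible
      gain.\<close>
    proof (cases "Sup V = measure M B")
      case True
      with up that show ?thesis by (intro exI[of _ B]) (auto simp: Q_def)
    next
      case False
      with cSup_upper[OF ne bdd] have "(Sup V + measure M B) / 2 < Sup V" by simp
      then obtain D where "P D" "B \<subseteq> D" "(Sup V + measure M B) / 2 < measure M D"
        using less_cSup_iff[OF _ bdd] ne unfolding V_def by blast
      moreover from this up have "Q B D" unfolding Q_def by (fastforce simp: field_simps)
      ultimately show ?thesis by blast
    qed
  qed
  have "P {}" using t by (simp add: P_def)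
  then obtain B where B: "\<And>n. P (B n)" "\<And>n. Q (B n) (B (Suc n))"
    using dependent_nat_choice[of "\<lambda>_. P" "\<lambda>_. Q"] step by blast
  have inc: "incseq B" using B(2) by (auto intro: incseq_SucI simp: Q_def)
  define U where "U = (\<Union>n. B n)"
  have U: "U \<in> sets M" "U \<subseteq> A" using B(1) unfolding U_def P_def by auto
  have lim: "(\<lambda>n. measure M (B n)) \<longlonglongrightarrow> measure M U"
    unfolding U_def using B(1) inc by (intro finite_Lim_measure_incseq) (auto simp: P_def)
  have le: "measure M U \<le> t"
    using B(1) by (intro LIMSEQ_le_const2[OF lim]) (auto simp: P_def)
  have "measure M U = t"
  proof (rule ccontr)
    assume "measure M U \<noteq> t"
    with le have less: "measure M U < t" by simp
    have "0 < measure M (A - U)" using less t U A by (simp add: finite_measure_Diff)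
    with non_atomic_small_subset[OF na, of "A - U" "t - measure M U"] less A U
    obtain D where D: "D \<in> sets M" "D \<subseteq> A - U" "0 < measure M D" "measure M D < t - measure M U"
      by auto
    have m: "measure M (U \<union> D) = measure M U + measure M D"
      using D U by (intro finite_measure_Union) auto
    \<comment> \<open>\<open>U \<union> D\<close> is an admissible enlargement of every
      \<open>B n\<close>, so it bounds each gain of the chain from below. In the limit this gives
      \<open>measure M D \<le> 0\<close>.\<close>
    have "P (U \<union> D)" using D U m by (auto simp: P_def)
    moreover have "B n \<subseteq> U \<union> D" for n by (auto simp: U_def)
    ultimately have gain: "measure M U + measure M D - measure M (B n)
        \<le> 2 * (measure M (B (Suc n)) - measure M (B n))" for n
      using B(2)[of n] m unfolding Q_def by metis
    have "(\<lambda>n. 2 * (measure M (B (Suc n)) - measure M (B n))) \<longlonglongrightarrow> 2 * (measure M U - measure M U)"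
      by (intro tendsto_intros lim LIMSEQ_Suc)
    moreover have "(\<lambda>n. measure M U + measure M D - measure M (B n))
        \<longlonglongrightarrow> measure M U + measure M D - measure M U"
      by (intro tendsto_intros lim)
    ultimately have "measure M U + measure M D - measure M U \<le> 2 * (measure M U - measure M U)"
      using gain by (intro LIMSEQ_le) auto
    with D show False by simp
  qed
  with U that show thesis by blast
qed

text \<open>Pieces of measure \<open>c\<close> are cut off one at a time. The partition is encoded
  by a measurable label \<open>k\<close>, so that composing a sequence with \<open>k\<close> gives a
  function constant on each piece.\<close>

lemma non_atomic_equal_parts:
  assumes na: "non_atomic M" and "0 \<le> c"
  shows "A \<in> sets M \<Longrightarrow> measure M A = real (Suc n) * c \<Longrightarrow>
    \<exists>k\<in>measurable M (count_space (UNIV :: nat set)).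
      k ` A \<subseteq> {1..Suc n} \<and> (\<forall>j\<in>{1..Suc n}. measure M {w\<in>A. k w = j} = c)"
proof (induction n arbitrary: A)
  case 0
  then show ?case by (intro bexI[of _ "\<lambda>_. 1"]) auto
next
  case (Suc n)
  obtain B where B: "B \<in> sets M" "B \<subseteq> A" "measure M B = c"
    using non_atomic_intermediate_value[OF na Suc.prems(1), of c] Suc.prems(2) \<open>0 \<le> c\<close>
    by (auto simp: algebra_simps)
  have "measure M (A - B) = real (Suc n) * c"
    using B Suc.prems by (simp add: finite_measure_Diff algebra_simps)
  with Suc.IH[of "A - B"] B Suc.prems obtain k where
    k: "k \<in> measurable M (count_space (UNIV :: nat set))" "k ` (A - B) \<subseteq> {1..Suc n}"
      "\<And>j. j \<in> {1..Suc n} \<Longrightarrow> measure M {w\<in>A - B. k w = j} = c" by auto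
  define k' where "k' w = (if w \<in> B then Suc (Suc n) else k w)" for w
  \<comment> \<open>The old labels on \<open>A - B\<close> stay within \<open>{1..Suc n}\<close>, so
    the new label marks exactly \<open>B\<close> inside \<open>A\<close>.\<close>
  have "{w\<in>A. k' w = j} = (if j = Suc (Suc n) then B else {w\<in>A - B. k w = j})"
    if "j \<in> {1..Suc (Suc n)}" for j
    using that B k(2) by (auto simp: k'_def split: if_splits)
  then have "\<forall>j\<in>{1..Suc (Suc n)}. measure M {w\<in>A. k' w = j} = c"
    using B k(3) by auto
  moreover have "k' ` A \<subseteq> {1..Suc (Suc n)}" using k(2) by (force simp: k'_def)
  moreover have "k' \<in> measurable M (count_space UNIV)"
    unfolding k'_def using k(1) B(1) by measurable
  ultimately show ?case by blast
qed

section \<open>Integrals as finite sums over level sets\<close>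

lemma nn_integral_finite_range:
  fixes F :: "'b \<Rightarrow> real"
  assumes T: "finite T" "h ` space M \<subseteq> T"
    and h: "\<And>y. y \<in> T \<Longrightarrow> h -` {y} \<inter> space M \<in> sets M"
    and F: "\<And>y. y \<in> T \<Longrightarrow> 0 \<le> F y"
  shows "(\<integral>\<^sup>+ w. ennreal (F (h w)) \<partial>M) = ennreal (\<Sum>y\<in>T. measure M (h -` {y} \<inter> space M) * F y)"
proof -
  have "(\<integral>\<^sup>+ w. ennreal (F (h w)) \<partial>M)
      = (\<integral>\<^sup>+ w. (\<Sum>y\<in>T. ennreal (F y) * indicator (h -` {y} \<inter> space M) w) \<partial>M)"
  proof (rule nn_integral_cong)
    fix w assume w: "w \<in> space M"
    have "(\<Sum>y\<in>T. ennreal (F y) * indicator (h -` {y} \<inter> space M) w)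
        = (\<Sum>y\<in>T. if h w = y then ennreal (F y) else 0)"
      using w by (intro sum.cong) (auto simp: indicator_def)
    then show "ennreal (F (h w)) = (\<Sum>y\<in>T. ennreal (F y) * indicator (h -` {y} \<inter> space M) w)"
      using w T by auto
  qed
  also have "\<dots> = (\<Sum>y\<in>T. ennreal (F y) * emeasure M (h -` {y} \<inter> space M))"
    using h by (subst nn_integral_sum) (auto simp: nn_integral_cmult_indicator)
  also have "\<dots> = (\<Sum>y\<in>T. ennreal (measure M (h -` {y} \<inter> space M) * F y))"
    using F by (intro sum.cong) (auto simp: emeasure_eq_measure ennreal_mult mult.commute)
  also have "\<dots> = ennreal (\<Sum>y\<in>T. measure M (h -` {y} \<inter> space M) * F y)"
    using F by (intro sum_ennreal) auto
  finally show ?thesis .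
qed

end

subsection \<open>Weighted sums\<close>

text \<open>Concatenate \<open>n y\<close> copies of each \<open>y\<close> in \<open>T\<close>. The
  family is chosen before \<open>F\<close>, so one and the same family serves both sides of the
  summing inequality and every \<phi>.\<close>

lemma ex_sequence_with_multiplicities:
  fixes n :: "'a \<Rightarrow> nat"
  assumes "finite T"
  obtains m and z :: "nat \<Rightarrow> 'a" where
    "\<And>F :: 'a \<Rightarrow> real. (\<Sum>j=1..m. F (z j)) = (\<Sum>y\<in>T. real (n y) * F y)"
proof -
  have "\<exists>xs. (\<forall>F :: 'a \<Rightarrow> real. sum_list (map F xs) = (\<Sum>y\<in>T. real (n y) * F y))"
    using assms
  proof (induction T)
    case (insert y T)
    then obtain xs where "\<And>F :: 'a \<Rightarrow> real. sum_list (map F xs) = (\<Sum>y\<in>T. real (n y) * F y)" by blast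
    with insert.hyps show ?case
      by (intro exI[of _ "replicate (n y) y @ xs"]) (auto simp: sum_list_replicate)
  qed (auto intro: exI[of _ "[]"])
  then obtain xs where xs: "\<And>F :: 'a \<Rightarrow> real. sum_list (map F xs) = (\<Sum>y\<in>T. real (n y) * F y)" by blast
  \<comment> \<open>The shift by one reconciles list positions, which start at 0, with sums that
    start at 1.\<close>
  have "(\<Sum>j=1..length xs. F (xs ! (j - 1))) = (\<Sum>y\<in>T. real (n y) * F y)" for F :: "'a \<Rightarrow> real"
  proof -
    have "(\<Sum>j=1..length xs. F (xs ! (j - 1))) = (\<Sum>i<length xs. F (xs ! i))"
      by (simp add: sum.atLeast1_atMost_eq)
    then show ?thesis
      by (simp add: xs[symmetric] sum_list_sum_nth atLeast0LessThan)
  qed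
  then show thesis by (rule that)
qed

text \<open>The quotient lies between \<open>a - 1 / Suc k\<close> and \<open>a\<close>; scaling by
  \<open>Suc k\<close> avoids a zero denominator.\<close>

lemma floor_scaled_tendsto:
  fixes a :: real
  assumes "0 \<le> a"
  shows "(\<lambda>k. real (nat \<lfloor>real (Suc k) * a\<rfloor>) / real (Suc k)) \<longlonglongrightarrow> a"
proof (rule tendsto_sandwich)
  have b: "real (Suc k) * a - 1 \<le> real (nat \<lfloor>real (Suc k) * a\<rfloor>)"
    "real (nat \<lfloor>real (Suc k) * a\<rfloor>) \<le> real (Suc k) * a" for k
    using assms by simp_all
  show "\<forall>\<^sub>F k in sequentially. a - inverse (real (Suc k)) \<le> real (nat \<lfloor>real (Suc k) * a\<rfloor>) / real (Suc k)"
    using divide_right_mono[OF b(1), of "real (Suc k)" k for k]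
    by (intro always_eventually allI) (simp add: diff_divide_distrib inverse_eq_divide del: of_nat_Suc)
  show "\<forall>\<^sub>F k in sequentially. real (nat \<lfloor>real (Suc k) * a\<rfloor>) / real (Suc k) \<le> a"
    using b(2) by (intro always_eventually allI) (simp add: field_simps del: of_nat_Suc)
  show "(\<lambda>k. a - inverse (real (Suc k))) \<longlonglongrightarrow> a"
    using tendsto_diff[OF tendsto_const LIMSEQ_inverse_real_of_nat] by simp
qed simp

lemma SUP_ennreal_mult_left:
  assumes "0 \<le> c" "\<And>i. i \<in> I \<Longrightarrow> 0 \<le> F i"
  shows "(SUP i\<in>I. ennreal (c * F i)) = ennreal c * (SUP i\<in>I. ennreal (F i))"
  using assms by (simp add: SUP_mult_left_ennreal ennreal_mult cong: SUP_cong)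

lemma RS_abstract_1_summing_iff:
  assumes "\<And>\<phi> x b. \<phi> \<in> topspace K \<Longrightarrow> 0 \<le> R \<phi> x b" and "\<And>x b. 0 \<le> S u x b"
  shows "RS_abstract_summing K R S 1 u \<longleftrightarrow>
    (\<exists>C>0. \<forall>(m::nat) x b. ennreal (\<Sum>j=1..m. S u (x j) (b j))
       \<le> ennreal C * (SUP \<phi>\<in>topspace K. ennreal (\<Sum>j=1..m. R \<phi> (x j) (b j))))"
  using assms unfolding RS_abstract_summing_def by (simp add: sum_nonneg cong: SUP_cong)

lemma weighted_sum_le_SUP:
  fixes s :: "'a \<Rightarrow> real" and r :: "'k \<Rightarrow> 'a \<Rightarrow> real"
  assumes sum_le: "\<And>(m::nat) z. ennreal (\<Sum>j=1..m. s (z j)) \<le> ennreal C * (SUP \<phi>\<in>I. ennreal (\<Sum>j=1..m. r \<phi> (z j)))"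
    and s: "\<And>y. 0 \<le> s y" and r: "\<And>\<phi> y. \<phi> \<in> I \<Longrightarrow> 0 \<le> r \<phi> y"
    and T: "finite T" and a: "\<And>y. 0 \<le> a y"
  shows "ennreal (\<Sum>y\<in>T. a y * s y) \<le> ennreal C * (SUP \<phi>\<in>I. ennreal (\<Sum>y\<in>T. a y * r \<phi> y))"
proof -
  define n where "n k y = nat \<lfloor>real (Suc k) * a y\<rfloor>" for k y
  have n: "real (n k y) / real (Suc k) \<le> a y" for k y
  proof -
    have "real (n k y) \<le> real (Suc k) * a y" using a[of y] by (simp add: n_def)
    then show ?thesis by (simp add: field_simps del: of_nat_Suc)
  qed
  \<comment> \<open>The bound already carries the exact weights \<open>a\<close> and does not depend
    on \<open>k\<close>, so only the finite sum on the left has to pass to the limit.\<close>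
  have le: "ennreal (\<Sum>y\<in>T. real (n k y) / real (Suc k) * s y)
      \<le> ennreal C * (SUP \<phi>\<in>I. ennreal (\<Sum>y\<in>T. a y * r \<phi> y))" for k
  proof -
    let ?d = "inverse (real (Suc k))"
    have pull: "(\<Sum>y\<in>T. real (n k y) / real (Suc k) * F y) = ?d * (\<Sum>y\<in>T. real (n k y) * F y)" for F
      by (simp add: sum_distrib_left divide_inverse mult_ac del: of_nat_Suc)
    obtain m and z :: "nat \<Rightarrow> 'a" where z: "\<And>F :: 'a \<Rightarrow> real. (\<Sum>j=1..m. F (z j)) = (\<Sum>y\<in>T. real (n k y) * F y)"
      using ex_sequence_with_multiplicities[OF T, of "n k"] by metis
    have "ennreal (\<Sum>y\<in>T. real (n k y) / real (Suc k) * s y)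
        = ennreal ?d * ennreal (\<Sum>y\<in>T. real (n k y) * s y)"
      unfolding pull using s by (intro ennreal_mult) (auto intro!: sum_nonneg)
    also have "\<dots> \<le> ennreal ?d * (ennreal C * (SUP \<phi>\<in>I. ennreal (\<Sum>y\<in>T. real (n k y) * r \<phi> y)))"
      using sum_le[of z m] unfolding z by (intro mult_left_mono) auto
    also have "\<dots> = ennreal C * (SUP \<phi>\<in>I. ennreal (\<Sum>y\<in>T. real (n k y) / real (Suc k) * r \<phi> y))"
      unfolding pull using r
      by (subst SUP_ennreal_mult_left) (auto intro!: sum_nonneg simp: mult_ac simp del: of_nat_Suc)
    also have "\<dots> \<le> ennreal C * (SUP \<phi>\<in>I. ennreal (\<Sum>y\<in>T. a y * r \<phi> y))"
      using n r by (intro mult_left_mono SUP_subset_mono order_refl ennreal_leI sum_mono mult_right_mono)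
        (auto simp del: of_nat_Suc)
    finally show ?thesis .
  qed
  have "(\<lambda>k. ennreal (\<Sum>y\<in>T. real (n k y) / real (Suc k) * s y)) \<longlonglongrightarrow> ennreal (\<Sum>y\<in>T. a y * s y)"
    unfolding n_def by (intro tendsto_ennrealI tendsto_sum tendsto_mult tendsto_const floor_scaled_tendsto a)
  from LIMSEQ_le_const2[OF this] le show ?thesis by blast
qed

section \<open>Equivalence of the sum and integral inequalities\<close>

theorem theorem3:
  fixes X :: "'x set" and Y :: "'y set" and H :: "('x \<Rightarrow> 'y) set"
    and K :: "'k topology"
    and R :: "'k \<Rightarrow> 'e::banach \<Rightarrow> 'g::banach \<Rightarrow> real"
    and S :: "('x \<Rightarrow> 'y) \<Rightarrow> 'e \<Rightarrow> 'g \<Rightarrow> real"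
    and \<mu> :: "'w measure"
    and M :: "('w \<Rightarrow> 'e) set set" and N :: "('w \<Rightarrow> 'g) set set"
    and u :: "'x \<Rightarrow> 'y"
  assumes H: "H \<subseteq> X \<rightarrow>\<^sub>E Y"
    and K: "compact_space K" "Hausdorff_space K"
    and R_nonneg: "\<And>\<phi> x b. \<phi> \<in> topspace K \<Longrightarrow> 0 \<le> R \<phi> x b"
    and S_nonneg: "\<And>v x b. v \<in> H \<Longrightarrow> 0 \<le> S v x b"
    and R_cont: "\<And>x b. continuous_map K euclideanreal (\<lambda>\<phi>. R \<phi> x b)"
    and S_zero: "\<And>v b. v \<in> H \<Longrightarrow> S v 0 b = 0" "\<And>v x. v \<in> H \<Longrightarrow> S v x 0 = 0"
    and R_zero: "\<And>\<phi> b. \<phi> \<in> topspace K \<Longrightarrow> R \<phi> 0 b = 0" "\<And>\<phi> x. \<phi> \<in> topspace K \<Longrightarrow> R \<phi> x 0 = 0"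
    and \<mu>: "finite_measure \<mu>" "non_atomic \<mu>" "0 < emeasure \<mu> (space \<mu>)"
    and M: "M \<subseteq> strongly_measurable_classes \<mu>" "\<And>f. simple_function \<mu> f \<Longrightarrow> f \<in> \<Union>M"
    and N: "N \<subseteq> strongly_measurable_classes \<mu>" "\<And>g. simple_function \<mu> g \<Longrightarrow> g \<in> \<Union>N"
    (* the completion makes this independent of the representatives f and g *)
    and R_integrable: "\<And>\<phi> f g. \<phi> \<in> topspace K \<Longrightarrow> f \<in> \<Union>M \<Longrightarrow> g \<in> \<Union>N \<Longrightarrow>
          integrable (completion \<mu>) (\<lambda>w. R \<phi> (f w) (g w))"
    and u: "u \<in> H"
  shows "RS_abstract_summing K R S 1 u \<longleftrightarrow>
    (\<exists>C>0. \<forall>f\<in>\<Union>M. \<forall>g\<in>\<Union>N. simple_function \<mu> f \<longrightarrow> simple_function \<mu> g \<longrightarrow>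
       (\<integral>\<^sup>+ w. ennreal (S u (f w) (g w)) \<partial>\<mu>)
         \<le> ennreal C * (SUP \<phi>\<in>topspace K. \<integral>\<^sup>+ w. ennreal (R \<phi> (f w) (g w)) \<partial>\<mu>))"
proof -
  interpret finite_measure \<mu> by fact
  let ?sums = "\<lambda>C. \<forall>(m::nat) x b. ennreal (\<Sum>j=1..m. S u (x j) (b j))
       \<le> ennreal C * (SUP \<phi>\<in>topspace K. ennreal (\<Sum>j=1..m. R \<phi> (x j) (b j)))"
  let ?ints = "\<lambda>C. \<forall>f\<in>\<Union>M. \<forall>g\<in>\<Union>N. simple_function \<mu> f \<longrightarrow> simple_function \<mu> g \<longrightarrow>
       (\<integral>\<^sup>+ w. ennreal (S u (f w) (g w)) \<partial>\<mu>)
         \<le> ennreal C * (SUP \<phi>\<in>topspace K. \<integral>\<^sup>+ w. ennreal (R \<phi> (f w) (g w)) \<partial>\<mu>)"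
  have Su: "0 \<le> S u x b" for x b using S_nonneg u by blast
  \<comment> \<open>Both directions preserve the constant, so the equivalence is shown for each
    \<open>C\<close> separately.\<close>
  have "?sums C \<longleftrightarrow> ?ints C" for C
  proof
    assume sums: "?sums C"
    show "?ints C"
    proof (intro ballI impI)
      fix f :: "'w \<Rightarrow> 'e" and g :: "'w \<Rightarrow> 'g"
      assume fg: "simple_function \<mu> f" "simple_function \<mu> g"
      \<comment> \<open>On a level set of the pair both functions are constant, so all the
        integrands depend on \<open>h w\<close> alone and share the weights
        \<open>a\<close>.\<close>
      define h where "h w = (f w, g w)" for w
      define T where "T = h ` space \<mu>"
      define a where "a y = measure \<mu> (h -` {y} \<inter> space \<mu>)" for y
      have "simple_function \<mu> h" unfolding h_def using fg by (rule simple_function_Pair)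
      then have T: "finite T" and h: "\<And>y. y \<in> T \<Longrightarrow> h -` {y} \<inter> space \<mu> \<in> sets \<mu>"
        unfolding T_def simple_function_def by auto
      have int: "(\<integral>\<^sup>+ w. ennreal (F (f w) (g w)) \<partial>\<mu>) = ennreal (\<Sum>y\<in>T. a y * F (fst y) (snd y))"
        if "\<And>x b. 0 \<le> F x b" for F
        using nn_integral_finite_range[OF T _ h, of "\<lambda>y. F (fst y) (snd y)"] that
        by (simp add: T_def h_def a_def)
      have "ennreal (\<Sum>y\<in>T. a y * S u (fst y) (snd y))
          \<le> ennreal C * (SUP \<phi>\<in>topspace K. ennreal (\<Sum>y\<in>T. a y * R \<phi> (fst y) (snd y)))"
      proof (rule weighted_sum_le_SUP[OF _ _ _ T])
        fix m and z :: "nat \<Rightarrow> 'e \<times> 'g"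
        show "ennreal (\<Sum>j=1..m. S u (fst (z j)) (snd (z j)))
            \<le> ennreal C * (SUP \<phi>\<in>topspace K. ennreal (\<Sum>j=1..m. R \<phi> (fst (z j)) (snd (z j))))"
          using sums[rule_format, of "\<lambda>j. fst (z j)" "\<lambda>j. snd (z j)" m] .
      qed (auto simp: a_def Su R_nonneg)
      then show "(\<integral>\<^sup>+ w. ennreal (S u (f w) (g w)) \<partial>\<mu>)
          \<le> ennreal C * (SUP \<phi>\<in>topspace K. \<integral>\<^sup>+ w. ennreal (R \<phi> (f w) (g w)) \<partial>\<mu>)"
        by (simp add: int Su R_nonneg cong: SUP_cong)
    qed
  next
    assume ints: "?ints C"
    show "?sums C"
    proof (intro allI)
      fix m :: nat and x :: "nat \<Rightarrow> 'e" and b :: "nat \<Rightarrow> 'g"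
      show "ennreal (\<Sum>j=1..m. S u (x j) (b j))
          \<le> ennreal C * (SUP \<phi>\<in>topspace K. ennreal (\<Sum>j=1..m. R \<phi> (x j) (b j)))"
      \<comment> \<open>For \<open>m = 0\<close> the left-hand sum is empty; the other case divides
        the space into \<open>m\<close> parts.\<close>
      proof (cases m)
        case (Suc n)
        define c where "c = measure \<mu> (space \<mu>) / real m"
        have c: "0 < c" using \<mu>(3) Suc by (simp add: c_def emeasure_eq_measure)
        have "measure \<mu> (space \<mu>) = real (Suc n) * c" using Suc by (simp add: c_def)
        from non_atomic_equal_parts[OF \<mu>(2) _ sets.top this] c Suc obtain k where
          k: "k \<in> measurable \<mu> (count_space (UNIV :: nat set))" "k ` space \<mu> \<subseteq> {1..m}"
            "\<And>j. j \<in> {1..m} \<Longrightarrow> measure \<mu> {w\<in>space \<mu>. k w = j} = c" by auto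
        have ks: "k -` {j} \<inter> space \<mu> \<in> sets \<mu>" for j
          using measurable_sets[OF k(1), of "{j}"] by simp
        have simple: "simple_function \<mu> k"
          unfolding simple_function_def using k(2) ks by (auto intro: finite_subset)
        have "k -` {j} \<inter> space \<mu> = {w\<in>space \<mu>. k w = j}" for j by auto
        with k(3) have "measure \<mu> (k -` {j} \<inter> space \<mu>) = c" if "j \<in> {1..m}" for j
          using that by simp
        then have int: "(\<integral>\<^sup>+ w. ennreal (F (k w)) \<partial>\<mu>) = ennreal (c * (\<Sum>j=1..m. F j))"
          if "\<And>j. 0 \<le> F j" for F
          using nn_integral_finite_range[OF _ k(2) ks, of F] that by (simp add: sum_distrib_left)
        have sf: "simple_function \<mu> (\<lambda>w. x (k w))" "simple_function \<mu> (\<lambda>w. b (k w))"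
          using simple by (auto intro: simple_function_compose1)
        have "ennreal (c * (\<Sum>j=1..m. S u (x j) (b j)))
            \<le> ennreal C * (SUP \<phi>\<in>topspace K. ennreal (c * (\<Sum>j=1..m. R \<phi> (x j) (b j))))"
          using ints[rule_format, OF M(2)[OF sf(1)] N(2)[OF sf(2)] sf]
          by (simp add: int[of "\<lambda>j. S u (x j) (b j)"] int[of "\<lambda>j. R \<phi> (x j) (b j)" for \<phi>]
              Su R_nonneg cong: SUP_cong)
        \<comment> \<open>The common measure \<open>c\<close> is pulled out of the supremum and
          cancelled, being positive and finite.\<close>
        then have "ennreal c * ennreal (\<Sum>j=1..m. S u (x j) (b j))
            \<le> ennreal c * (ennreal C * (SUP \<phi>\<in>topspace K. ennreal (\<Sum>j=1..m. R \<phi> (x j) (b j))))"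
          using c by (subst (asm) SUP_ennreal_mult_left)
            (auto simp: ennreal_mult sum_nonneg Su R_nonneg mult_ac)
        then show ?thesis
          using c by (subst (asm) ennreal_mult_le_mult_iff) auto
      qed simp
    qed
  qed
  then show ?thesis
    using RS_abstract_1_summing_iff[of K R S u] R_nonneg Su by simp
qed

end
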